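(* Let $\mathcal H=\{X_1,\dots,X_m\}$ be a family of vector fields on $\mathbb R^n$ of class $C^1$ in the Euclidean sense, $X_j=f_j\cdot\nabla$, and assume that $f_j\in C^{2,1}_{\mathcal H,\mathrm{loc}}$ for all $j\in\{1,\dots,m\}$. Then $$[X_i,[X_j,X_k]]=\operatorname{ad}_{X_i}X_{jk}\qquad\text{for all } i,j,k\in\{1,\dots,m\},$$ as first order differential operators acting on $C^1$ functions.
   Context: Vector fields $X=f\cdot\nabla$ on $\mathbb R^n$ have coefficient $f:\mathbb R^n\to\mathbb R^n$; $e^{tX}x$ is the (local) flow of a $C^1$ vector field $X$ at time $t$ from $x$. For a function $g$ (scalar, or vector valued, componentwise), $X^\sharp g(x):=\lim_{t\to0}\frac1t\big(g(e^{tX}x)-g(x)\big)$ denotes the Lie derivative, when it exists. Distance: for the family $\mathcal H$, $d(x,y):=\inf\{r>0:\ y=e^{t_1Z_1}\cdots e^{t_\mu Z_\mu}x$ for some $\mu\in\mathbb N$, with $\sum_j|t_j|\le1$ and $Z_j\in\{rX_1,\dots,rX_m\}\}$, with $d(x,y)=+\infty$ if there are no such representations. A function $g$ is $d$-Lipschitz on $A$ if $\sup_{x\ne y\in A}|g(x)-g(y)|/d(x,y)<\infty$. $g\in C^{k,1}_{\mathcal H,\mathrm{loc}}$ means that all the derivatives $X_{j_1}^\sharp\cdots X_{j_k}^\sharp g$ ($j_1,\dots,j_k\in\{1,\dots,m\}$) exist and are $d$-Lipschitz on each Euclidean-bounded set. Commutators: $X_{jk}:=f_{jk}\cdot\nabla$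 with $f_{jk}:=X_j^\sharp f_k-X_k^\sharp f_j$; $$[X_i,[X_j,X_k]]:=\big(X_i^\sharp X_j^\sharp f_k-X_i^\sharp X_k^\sharp f_j-X_j^\sharp X_k^\sharp f_i+X_k^\sharp X_j^\sharp f_i\big)\cdot\nabla ,$$ $$\operatorname{ad}_{X_i}X_{jk}:=\big(X_i^\sharp f_{jk}-X_{jk}f_i\big)\cdot\nabla,\qquad X_{jk}f_i:=f_{jk}\cdot\nabla f_i .$$ *)

theory Defs
  imports "HOL-Analysis.Analysis"
begin

definition C1_map :: "('a::real_normed_vector \<Rightarrow> 'b::real_normed_vector) \<Rightarrow> bool" where
  "C1_map g \<longleftrightarrow>
     (\<exists>g' :: 'a \<Rightarrow> 'a \<Rightarrow>\<^sub>L 'b.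
        (\<forall>x. (g has_derivative blinfun_apply (g' x)) (at x)) \<and> continuous_on UNIV g')"

text \<open>A vector field is represented by its coefficient function. The flow is only local, so
  it is introduced as a relation: an integral curve from \<open>x\<close> to \<open>y\<close> exists on the whole
  (possibly reversed, if \<open>t < 0\<close>) interval between \<open>0\<close> and \<open>t\<close>.\<close>

definition flows_to ::
    "('a::real_normed_vector \<Rightarrow> 'a) \<Rightarrow> real \<Rightarrow> 'a \<Rightarrow> 'a \<Rightarrow> bool" where
  "flows_to f t x y \<longleftrightarrow>
     (\<exists>\<gamma>. \<gamma> 0 = x \<and> \<gamma> t = y \<and>
        (\<forall>s\<in>closed_segment 0 t.
           (\<gamma> has_vector_derivative f (\<gamma> s)) (at s within closed_segment 0 t)))"

text \<open>Unspecified if \<open>t\<close> is outside the maximal interval of existence at \<open>x\<close>; this does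
  not affect limits as \<open>t\<close> tends to \<open>0\<close>.\<close>

definition flow :: "('a::real_normed_vector \<Rightarrow> 'a) \<Rightarrow> real \<Rightarrow> 'a \<Rightarrow> 'a" where
  "flow f t x = (THE y. flows_to f t x y)"

definition lie_quotient ::
    "('a::real_normed_vector \<Rightarrow> 'a) \<Rightarrow> ('a \<Rightarrow> 'b::real_normed_vector) \<Rightarrow> 'a \<Rightarrow> real \<Rightarrow> 'b" where
  "lie_quotient f g x = (\<lambda>t. (1 / t) *\<^sub>R (g (flow f t x) - g x))"

definition lie_differentiable ::
    "('a::real_normed_vector \<Rightarrow> 'a) \<Rightarrow> ('a \<Rightarrow> 'b::real_normed_vector) \<Rightarrow> 'a \<Rightarrow> bool" where
  "lie_differentiable f g x \<longleftrightarrow> (\<exists>L. (lie_quotient f g x \<longlongrightarrow> L) (at 0))"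

definition lie_deriv ::
    "('a::real_normed_vector \<Rightarrow> 'a) \<Rightarrow> ('a \<Rightarrow> 'b::real_normed_vector) \<Rightarrow> 'a \<Rightarrow> 'b" where
  "lie_deriv f g x = Lim (at 0) (lie_quotient f g x)"

text \<open>For \<open>js = [j\<^sub>1, \<dots>, j\<^sub>k]\<close>, the derivative along \<open>f j\<^sub>k\<close> is taken first and the one
  along \<open>f j\<^sub>1\<close> last.\<close>

primrec lie_iter ::
    "(nat \<Rightarrow> 'a::real_normed_vector \<Rightarrow> 'a) \<Rightarrow> nat list \<Rightarrow>
     ('a \<Rightarrow> 'b::real_normed_vector) \<Rightarrow> 'a \<Rightarrow> 'b" where
  "lie_iter f [] g = g"
| "lie_iter f (j # js) g = lie_deriv (f j) (lie_iter f js g)"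

primrec lie_iter_exists ::
    "(nat \<Rightarrow> 'a::real_normed_vector \<Rightarrow> 'a) \<Rightarrow> nat list \<Rightarrow>
     ('a \<Rightarrow> 'b::real_normed_vector) \<Rightarrow> bool" where
  "lie_iter_exists f [] g \<longleftrightarrow> True"
| "lie_iter_exists f (j # js) g \<longleftrightarrow>
     lie_iter_exists f js g \<and> (\<forall>x. lie_differentiable (f j) (lie_iter f js g) x)"

text \<open>\<open>flow_chain [(t\<^sub>1, Z\<^sub>1), \<dots>, (t\<^sub>\<mu>, Z\<^sub>\<mu>)] x y\<close> says that
  \<open>e\<^bsup>t\<^sub>1Z\<^sub>1\<^esup> \<dots> e\<^bsup>t\<^sub>\<mu>Z\<^sub>\<mu>\<^esup> x\<close> is defined and equals \<open>y\<close>; the last factor acts first.\<close>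

primrec flow_chain ::
    "(real \<times> ('a::real_normed_vector \<Rightarrow> 'a)) list \<Rightarrow> 'a \<Rightarrow> 'a \<Rightarrow> bool" where
  "flow_chain [] x y \<longleftrightarrow> y = x"
| "flow_chain (p # ps) x y \<longleftrightarrow> (\<exists>z. flow_chain ps x z \<and> flows_to (snd p) (fst p) z y)"

text \<open>The infimum is taken in the extended nonnegative reals, so it is \<open>\<infinity>\<close> if there is
  no admissible \<open>r\<close>.\<close>

definition sr_dist ::
    "(nat \<Rightarrow> 'a::real_normed_vector \<Rightarrow> 'a) \<Rightarrow> nat \<Rightarrow> 'a \<Rightarrow> 'a \<Rightarrow> ennreal" where
  "sr_dist f m x y =
     Inf {ennreal r | r. r > 0 \<and>
       (\<exists>ps. ps \<noteq> [] \<and>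
          (\<forall>p\<in>set ps. snd p \<in> {\<lambda>z. r *\<^sub>R f j z | j. j \<in> {1..m}}) \<and>
          (\<Sum>p\<leftarrow>ps. \<bar>fst p\<bar>) \<le> 1 \<and>
          flow_chain ps x y)}"

text \<open>In \<^typ>\<open>ennreal\<close> one has \<open>a / \<infinity> = 0\<close> for finite \<open>a\<close>, and \<open>a / 0 = \<infinity>\<close>
  for \<open>a > 0\<close>, so pairs at infinite distance impose no condition.\<close>

definition d_lipschitz_on ::
    "(nat \<Rightarrow> 'a::real_normed_vector \<Rightarrow> 'a) \<Rightarrow> nat \<Rightarrow> 'a set \<Rightarrow>
     ('a \<Rightarrow> 'b::real_normed_vector) \<Rightarrow> bool" where
  "d_lipschitz_on f m A g \<longleftrightarrow>
     (SUP (x, y)\<in>{(x, y). x \<in> A \<and> y \<in> A \<and> x \<noteq> y}.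
        ennreal (norm (g x - g y)) / sr_dist f m x y) < \<infinity>"

definition C_k1_H_loc ::
    "(nat \<Rightarrow> 'a::real_normed_vector \<Rightarrow> 'a) \<Rightarrow> nat \<Rightarrow> nat \<Rightarrow>
     ('a \<Rightarrow> 'b::real_normed_vector) \<Rightarrow> bool" where
  "C_k1_H_loc f m k g \<longleftrightarrow>
     (\<forall>js. length js = k \<and> set js \<subseteq> {1..m} \<longrightarrow>
        lie_iter_exists f js g \<and>
        (\<forall>A. bounded A \<longrightarrow> d_lipschitz_on f m A (lie_iter f js g)))"

text \<open>The first order operator \<open>f \<cdot> \<nabla>\<close>, applied to scalar or vector valued functions.\<close>

definition vf_op ::
    "('a::real_normed_vector \<Rightarrow> 'a) \<Rightarrow> ('a \<Rightarrow> 'b::real_normed_vector) \<Rightarrow> 'a \<Rightarrow> 'b" where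
  "vf_op f \<psi> x = frechet_derivative \<psi> (at x) (f x)"

definition comm_coeff ::
    "(nat \<Rightarrow> 'a::real_normed_vector \<Rightarrow> 'a) \<Rightarrow> nat \<Rightarrow> nat \<Rightarrow> 'a \<Rightarrow> 'a" where
  "comm_coeff f j k x = lie_deriv (f j) (f k) x - lie_deriv (f k) (f j) x"

definition double_comm_coeff ::
    "(nat \<Rightarrow> 'a::real_normed_vector \<Rightarrow> 'a) \<Rightarrow> nat \<Rightarrow> nat \<Rightarrow> nat \<Rightarrow> 'a \<Rightarrow> 'a" where
  "double_comm_coeff f i j k x =
     lie_deriv (f i) (lie_deriv (f j) (f k)) x - lie_deriv (f i) (lie_deriv (f k) (f j)) x
     - lie_deriv (f j) (lie_deriv (f k) (f i)) x + lie_deriv (f k) (lie_deriv (f j) (f i)) x"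

definition ad_coeff ::
    "(nat \<Rightarrow> 'a::real_normed_vector \<Rightarrow> 'a) \<Rightarrow> nat \<Rightarrow> nat \<Rightarrow> nat \<Rightarrow> 'a \<Rightarrow> 'a" where
  "ad_coeff f i j k x =
     lie_deriv (f i) (comm_coeff f j k) x - vf_op (comm_coeff f j k) (f i) x"

end

theory Submission
  imports Defs
begin

text \<open>By linearity of \<open>X\<^sub>i\<^sup>\<sharp>\<close> the claim reduces to
  \<open>X\<^sub>j\<^sup>\<sharp>X\<^sub>k\<^sup>\<sharp>g - X\<^sub>k\<^sup>\<sharp>X\<^sub>j\<^sup>\<sharp>g = f\<^sub>j\<^sub>k \<cdot> \<nabla>g\<close> for \<open>g = f\<^sub>i\<close>. Write \<open>X = X\<^sub>j\<close>, \<open>Y = X\<^sub>k\<close>. A second order Taylor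
  expansion along the two flows gives
  \<open>g(e\<^bsup>tY\<^esup>e\<^bsup>tX\<^esup>x) = g(x) + t(Xg + Yg)(x) + t\<^sup>2(XXg/2 + XYg + YYg/2)(x) + o(t\<^sup>2)\<close>; it only needs \<open>XXg\<close> and
  \<open>YYg\<close> to be continuous along such chains of flows, which \<open>d\<close>-Lipschitz continuity provides.
  Hence \<open>g(e\<^bsup>tY\<^esup>e\<^bsup>tX\<^esup>x) - g(e\<^bsup>tX\<^esup>e\<^bsup>tY\<^esup>x) = t\<^sup>2(XYg - YXg)(x) + o(t\<^sup>2)\<close>. The same formula for the identity in place
  of \<open>g\<close> says that the two end points differ by \<open>t\<^sup>2f\<^sub>j\<^sub>k(x) + o(t\<^sup>2)\<close>, and since \<open>g\<close> is \<open>C\<^sup>1\<close>, hence strictly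
  differentiable, the left-hand side is also \<open>t\<^sup>2f\<^sub>j\<^sub>k\<cdot>\<nabla>g(x) + o(t\<^sup>2)\<close>.\<close>

section \<open>Integral curves and local flows\<close>

lemma has_vector_derivative_norm_bound:
  fixes u :: "real \<Rightarrow> 'a::real_normed_vector"
  assumes deriv: "\<And>s. s \<in> S \<Longrightarrow> (u has_vector_derivative u' s) (at s within S)"
    and bound: "\<And>s. s \<in> S \<Longrightarrow> norm (u' s) \<le> B"
    and "convex S" "r \<in> S" "s \<in> S"
  shows "norm (u s - u r) \<le> B * \<bar>s - r\<bar>"
proof -
  have "onorm (\<lambda>h. h *\<^sub>R u' r) \<le> B" if "r \<in> S" for r
    using bound[OF that] by (simp add: onorm_scaleR_left onorm_id)
  then have "norm (u s - u r) \<le> B * norm (s - r)"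
    using assms unfolding has_vector_derivative_def
    by (intro differentiable_bound[of S u "\<lambda>r h. h *\<^sub>R u' r" B s r]) auto
  then show ?thesis by simp
qed

text \<open>The right-hand side has the shape of \<open>lie_quotient\<close>, so derivatives of
  curves and Lie derivatives can be converted into each other.\<close>

lemma has_vector_derivative_iff_tendsto:
  fixes u :: "real \<Rightarrow> 'a::real_normed_vector"
  shows "(u has_vector_derivative D) (at s within S) \<longleftrightarrow>
    ((\<lambda>r. (1 / (r - s)) *\<^sub>R (u r - u s)) \<longlongrightarrow> D) (at s within S)"
proof -
  have "(u has_vector_derivative D) (at s within S) \<longleftrightarrow>
      ((\<lambda>r. (1 / norm (r - s)) *\<^sub>R (u r - (u s + (r - s) *\<^sub>R D))) \<longlongrightarrow> 0) (at s within S)"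
    unfolding has_vector_derivative_def has_derivative_within
    by (simp add: bounded_linear_scaleR_left)
  \<comment> \<open>The factors 1/|r - s| and 1/(r - s) may differ by a sign, so the two quotients
    are compared only after taking norms.\<close>
  also have "\<dots> \<longleftrightarrow> ((\<lambda>r. norm ((1 / norm (r - s)) *\<^sub>R (u r - (u s + (r - s) *\<^sub>R D)))) \<longlongrightarrow> 0)
      (at s within S)"
    by (rule tendsto_norm_zero_iff[symmetric])
  also have "\<dots> \<longleftrightarrow> ((\<lambda>r. norm ((1 / (r - s)) *\<^sub>R (u r - u s) - D)) \<longlongrightarrow> 0) (at s within S)"
  proof (rule tendsto_cong)
    have "norm ((1 / norm (r - s)) *\<^sub>R (u r - (u s + (r - s) *\<^sub>R D)))
        = norm ((1 / (r - s)) *\<^sub>R (u r - u s) - D)" if "r \<noteq> s" for r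
    proof -
      have "(1 / (r - s)) *\<^sub>R (u r - u s) - D = (1 / (r - s)) *\<^sub>R (u r - (u s + (r - s) *\<^sub>R D))"
        using that by (simp add: diff_diff_eq[symmetric] scaleR_diff_right)
      then show ?thesis by simp
    qed
    then show "\<forall>\<^sub>F r in at s within S. norm ((1 / norm (r - s)) *\<^sub>R (u r - (u s + (r - s) *\<^sub>R D)))
        = norm ((1 / (r - s)) *\<^sub>R (u r - u s) - D)"
      by (auto simp: eventually_at_filter)
  qed
  also have "\<dots> \<longleftrightarrow> ((\<lambda>r. (1 / (r - s)) *\<^sub>R (u r - u s)) \<longlongrightarrow> D) (at s within S)"
    by (simp only: tendsto_norm_zero_iff LIM_zero_iff)
  finally show ?thesis .
qed

lemma C1_map_Lipschitz_on_cball: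
  fixes g :: "'a::euclidean_space \<Rightarrow> 'b::real_normed_vector"
  assumes "C1_map g"
  obtains L where "L \<ge> 0"
    "\<And>x y. x \<in> cball c r \<Longrightarrow> y \<in> cball c r \<Longrightarrow> norm (g x - g y) \<le> L * norm (x - y)"
proof -
  from assms obtain g' where
    g': "\<And>x. (g has_derivative blinfun_apply (g' x)) (at x)" "continuous_on UNIV g'"
    unfolding C1_map_def by blast
  have "compact (g' ` cball c r)"
    using g'(2) by (intro compact_continuous_image) (auto intro: continuous_on_subset)
  then obtain L where L: "L > 0" "\<And>x. x \<in> cball c r \<Longrightarrow> norm (g' x) \<le> L"
    using compact_imp_bounded bounded_pos by (metis imageI)
  have "norm (g x - g y) \<le> L * norm (x - y)" if "x \<in> cball c r" "y \<in> cball c r" for x y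
    using g'(1) L(2) that
    by (intro differentiable_bound[of "cball c r" g "\<lambda>x. blinfun_apply (g' x)"])
       (auto simp: norm_blinfun.rep_eq[symmetric] intro: has_derivative_at_withinI)
  with L(1) show ?thesis by (intro that[of L]) auto
qed

lemma C1_map_continuous_on:
  assumes "C1_map g"
  shows "continuous_on S g"
  using assms unfolding C1_map_def
  by (meson continuous_at_imp_continuous_on has_derivative_continuous)

section \<open>Uniqueness and existence of integral curves\<close>

lemma integral_curve_unique:
  fixes X :: "'a::euclidean_space \<Rightarrow> 'a"
  assumes C1: "C1_map X"
    and u: "\<And>s. s \<in> {0..t} \<Longrightarrow> (u has_vector_derivative X (u s)) (at s within {0..t})"
    and v: "\<And>s. s \<in> {0..t} \<Longrightarrow> (v has_vector_derivative X (v s)) (at s within {0..t})"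
    and init: "u 0 = v 0" and t: "t \<ge> 0"
  shows "u t = v t"
proof -
  have cont: "continuous_on {0..t} u" "continuous_on {0..t} v"
    by (rule continuous_on_vector_derivative, erule u, rule continuous_on_vector_derivative, erule v)
  \<comment> \<open>Both images are compact, so a single ball, and hence a single Lipschitz constant
    of \<open>X\<close>, serves both curves.\<close>
  have "bounded (u ` {0..t} \<union> v ` {0..t})"
    using cont by (auto intro!: compact_imp_bounded compact_continuous_image)
  then obtain r where r: "u ` {0..t} \<union> v ` {0..t} \<subseteq> cball 0 r"
    using bounded_subset_cball bounded_subset_ballD[of _ 0] ball_subset_cball by (metis order_trans)
  obtain L where L: "L \<ge> 0"
    "\<And>x y. x \<in> cball 0 r \<Longrightarrow> y \<in> cball 0 r \<Longrightarrow> norm (X x - X y) \<le> L * norm (x - y)"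
    using C1_map_Lipschitz_on_cball[OF C1] by metis
  \<comment> \<open>Gronwall: the factor \<open>exp (- 2Ls)\<close> makes the squared distance of the two curves nonincreasing.\<close>
  define w where "w s = exp (- 2 * L * s) * ((u s - v s) \<bullet> (u s - v s))" for s
  define w' where "w' s = exp (- 2 * L * s) * (2 * ((X (u s) - X (v s)) \<bullet> (u s - v s))
      - 2 * L * ((u s - v s) \<bullet> (u s - v s)))" for s
  have w': "(w has_real_derivative w' s) (at s within {0..t})" if "s \<in> {0..t}" for s
  proof -
    have "((\<lambda>s. u s - v s) has_derivative (\<lambda>h. h *\<^sub>R (X (u s) - X (v s)))) (at s within {0..t})"
      using has_vector_derivative_diff[OF u[OF that] v[OF that]]
      by (simp add: has_vector_derivative_def)
    from has_derivative_inner[OF this this]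
    have "((\<lambda>s. (u s - v s) \<bullet> (u s - v s)) has_real_derivative
        2 * ((X (u s) - X (v s)) \<bullet> (u s - v s))) (at s within {0..t})"
      unfolding has_field_derivative_def
      by (rule has_derivative_eq_rhs) (auto simp: inner_commute algebra_simps)
    from DERIV_mult[OF _ this, of "\<lambda>s. exp (- 2 * L * s)" "exp (- 2 * L * s) * (- 2 * L)"]
    show ?thesis unfolding w_def[abs_def] w'_def
      by (rule DERIV_cong) (auto intro!: derivative_eq_intros simp: algebra_simps)
  qed
  have w'_le: "w' s \<le> 0" if "s \<in> {0..t}" for s
  proof -
    have "(X (u s) - X (v s)) \<bullet> (u s - v s) \<le> norm (X (u s) - X (v s)) * norm (u s - v s)"
      by (rule norm_cauchy_schwarz)
    also have "\<dots> \<le> (L * norm (u s - v s)) * norm (u s - v s)"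
      using r that by (intro mult_right_mono L(2) norm_ge_zero) blast+
    also have "\<dots> = L * ((u s - v s) \<bullet> (u s - v s))"
      by (simp add: power2_norm_eq_inner[symmetric] power2_eq_square)
    finally show ?thesis unfolding w'_def by (intro mult_nonneg_nonpos) auto
  qed
  obtain s where s: "s \<in> {0..t}" "w t - w 0 = w' s * (t - 0)"
    using mvt_very_simple[of 0 t w "\<lambda>s h. w' s * h"] t w' unfolding has_field_derivative_def by auto
  have "w t \<le> 0"
    using s w'_le[OF s(1)] t init mult_nonpos_nonneg[of "w' s" t] by (simp add: w_def)
  then show ?thesis unfolding w_def
    by (simp add: mult_le_0_iff power2_norm_eq_inner[symmetric])
qed

text \<open>Banach's fixed point theorem for the Picard operator on bounded continuous functions.
  The contraction constant is the sum of 2aL, from the integral over [-a, t], and aL, from the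
  integral over [-a, 0] that is subtracted to fix the initial value.\<close>

lemma Picard_Lindeloef_global:
  fixes F :: "'a::euclidean_space \<Rightarrow> 'a"
  assumes lip: "\<And>x y. norm (F x - F y) \<le> L * norm (x - y)"
    and "L \<ge> 0" "a \<ge> 0" "3 * a * L < 1"
  shows "\<exists>\<gamma>. \<gamma> 0 = z \<and> (\<forall>t\<in>{-a..a}. (\<gamma> has_vector_derivative F (\<gamma> t)) (at t within {-a..a}))"
proof -
  have "L-lipschitz_on UNIV F"
    using lip \<open>L \<ge> 0\<close> by (auto simp: lipschitz_on_def dist_norm)
  then have contF: "continuous_on UNIV F"
    by (rule lipschitz_on_continuous_on)
  \<comment> \<open>Integrating from -a and subtracting the value at 0 treats positive and negative
    times alike.\<close>
  define J where "J u t = integral {-a..t} (\<lambda>s. F (apply_bcontfun u s))" for u and t :: real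
  define I where "I u t = z + (J u t - J u 0)" for u and t :: real
  \<comment> \<open>Clamping extends the function constantly beyond the interval, since elements of
    the function space live on the whole line.\<close>
  define T where "T u = Bcontfun (\<lambda>t. I u (clamp (-a) a t))" for u
  have contFu: "continuous_on S (\<lambda>s. F (apply_bcontfun u s))" for S :: "real set" and u
    by (rule continuous_on_compose2[OF contF]) auto
  have contI: "continuous_on {-a..a} (I u)" for u
    unfolding I_def J_def
    by (intro continuous_intros indefinite_integral_continuous_1 integrable_continuous_real contFu)
  have T: "apply_bcontfun (T u) t = I u (clamp (-a) a t)" for u t
  proof -
    have "(\<lambda>t. I u (clamp (-a) a t)) \<in> bcontfun"
      unfolding bcontfun_def using contI[of u]
      by (auto intro!: clamp_continuous_on clamp_bounded compact_imp_bounded[OF compact_continuous_image])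
    then show ?thesis unfolding T_def by (simp add: Bcontfun_inverse)
  qed
  have J: "norm (J u c - J v c) \<le> (L * dist u v) * (c + a)" if "c \<in> {-a..a}" for u v c
  proof -
    have "J u c - J v c = integral {-a..c} (\<lambda>s. F (apply_bcontfun u s) - F (apply_bcontfun v s))"
      unfolding J_def
      by (subst integral_diff) (auto intro!: integrable_continuous_real contFu)
    also have "norm \<dots> \<le> (L * dist u v) * (c - (-a))"
    proof (rule integral_bound)
      fix s
      have "norm (F (apply_bcontfun u s) - F (apply_bcontfun v s))
          \<le> L * dist (apply_bcontfun u s) (apply_bcontfun v s)"
        using lip by (simp add: dist_norm)
      also have "\<dots> \<le> L * dist u v"
        using \<open>L \<ge> 0\<close> dist_bounded by (intro mult_left_mono) auto
      finally show "norm (F (apply_bcontfun u s) - F (apply_bcontfun v s)) \<le> L * dist u v" .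
    qed (use that in \<open>auto intro!: continuous_intros contFu\<close>)
    finally show ?thesis by simp
  qed
  have "dist (T u) (T v) \<le> (3 * a * L) * dist u v" for u v
  proof (rule dist_bound)
    fix t :: real
    let ?c = "clamp (-a) a t"
    have c: "?c \<in> {-a..a}" using clamp_in_interval[of "-a" a t] \<open>a \<ge> 0\<close> by simp
    have "norm (I u ?c - I v ?c) = norm ((J u ?c - J v ?c) - (J u 0 - J v 0))"
      by (simp add: I_def algebra_simps)
    also have "\<dots> \<le> (L * dist u v) * (?c + a) + (L * dist u v) * (0 + a)"
      using J[OF c, of u v] J[of 0 u v] \<open>a \<ge> 0\<close>
        norm_triangle_ineq4[of "J u ?c - J v ?c" "J u 0 - J v 0"] by auto
    also have "\<dots> \<le> (L * dist u v) * (a + a) + (L * dist u v) * (0 + a)"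
      using c \<open>L \<ge> 0\<close> by (intro add_mono mult_left_mono) auto
    finally show "dist (apply_bcontfun (T u) t) (apply_bcontfun (T v) t) \<le> (3 * a * L) * dist u v"
      by (simp add: T dist_norm algebra_simps)
  qed
  then obtain u where u: "T u = u"
    using banach_fix_type[of "3 * a * L" T] assms by auto
  have Iu: "I u t = apply_bcontfun u t" if "t \<in> {-a..a}" for t
    using T[of u t] that by (simp add: u)
  have "(apply_bcontfun u has_vector_derivative F (apply_bcontfun u t)) (at t within {-a..a})"
    if t: "t \<in> {-a..a}" for t
  proof (rule has_vector_derivative_transform[OF t])
    show "(I u has_vector_derivative F (apply_bcontfun u t)) (at t within {-a..a})"
      unfolding I_def J_def using t
      by (auto intro!: derivative_eq_intros integral_has_vector_derivative contFu)
  qed (simp add: Iu)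
  moreover have "apply_bcontfun u 0 = z"
    using Iu[of 0] \<open>a \<ge> 0\<close> by (simp add: I_def)
  ultimately show ?thesis by blast
qed

section \<open>Rescaling of time, and the flow as a function\<close>

lemma C1_map_scaleR:
  assumes "C1_map X"
  shows "C1_map (\<lambda>x. c *\<^sub>R X x)"
proof -
  from assms obtain X' where
    X': "\<And>x. (X has_derivative blinfun_apply (X' x)) (at x)" "continuous_on UNIV X'"
    unfolding C1_map_def by blast
  then show ?thesis unfolding C1_map_def
    by (intro exI[of _ "\<lambda>x. c *\<^sub>R X' x"])
       (auto intro!: derivative_eq_intros continuous_intros simp: scaleR_blinfun.rep_eq)
qed

text \<open>Multiplication by \<open>c\<close> maps the segment from 0 to \<open>r\<close> onto the
  one from 0 to \<open>c * r\<close> whatever the sign of \<open>c\<close>, so the chain rule covers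
  reversed and constant curves as well.\<close>

lemma integral_curve_rescale:
  fixes \<gamma> :: "real \<Rightarrow> 'a::real_normed_vector"
  assumes "\<And>s. s \<in> closed_segment 0 t \<Longrightarrow>
      (\<gamma> has_vector_derivative X (\<gamma> s)) (at s within closed_segment 0 t)"
    and "t = c * r" and "s \<in> closed_segment 0 r"
  shows "((\<lambda>s. \<gamma> (c * s)) has_vector_derivative c *\<^sub>R X (\<gamma> (c * s))) (at s within closed_segment 0 r)"
proof -
  have img: "(*) c ` closed_segment 0 r = closed_segment 0 t"
    using assms(2) by (auto simp: closed_segment_image_interval image_image mult_ac)
  have "((*) c has_vector_derivative c) (at s within closed_segment 0 r)"
    unfolding has_real_derivative_iff_has_vector_derivative[symmetric]
    by (auto intro!: derivative_eq_intros)
  moreover have "(\<gamma> has_vector_derivative X (\<gamma> (c * s))) (at (c * s) within (*) c ` closed_segment 0 r)"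
    unfolding img using img assms(3) by (intro assms(1)) blast
  ultimately show ?thesis
    using vector_diff_chain_within by (fastforce simp: comp_def)
qed

text \<open>Time is traded against speed; this serves both uniqueness of the flow and estimates of
  the control distance.\<close>

lemma flows_to_rescale:
  assumes "flows_to X (c * r) x y"
  shows "flows_to (\<lambda>z. c *\<^sub>R X z) r x y"
proof -
  from assms obtain \<gamma> where \<gamma>: "\<gamma> 0 = x" "\<gamma> (c * r) = y"
    "\<And>s. s \<in> closed_segment 0 (c * r) \<Longrightarrow>
      (\<gamma> has_vector_derivative X (\<gamma> s)) (at s within closed_segment 0 (c * r))"
    unfolding flows_to_def by blast
  show ?thesis unfolding flows_to_def
    using \<gamma> integral_curve_rescale[OF \<gamma>(3) refl]
    by (intro exI[of _ "\<lambda>s. \<gamma> (c * s)"]) auto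
qed

lemma flows_to_unique:
  fixes X :: "'a::euclidean_space \<Rightarrow> 'a"
  assumes C1: "C1_map X" and "flows_to X t x y" "flows_to X t x z"
  shows "y = z"
proof -
  \<comment> \<open>Passing to the field \<open>t *\<^sub>R X\<close> reduces every
    \<open>t\<close>, negative ones included, to forward unit time.\<close>
  have "flows_to (\<lambda>z. t *\<^sub>R X z) 1 x y" "flows_to (\<lambda>z. t *\<^sub>R X z) 1 x z"
    using assms(2,3) by (auto intro: flows_to_rescale)
  then obtain u v where
    "u 0 = x" "u 1 = y" "v 0 = x" "v 1 = z"
    "\<And>s. s \<in> {0..1} \<Longrightarrow> (u has_vector_derivative t *\<^sub>R X (u s)) (at s within {0..1})"
    "\<And>s. s \<in> {0..1} \<Longrightarrow> (v has_vector_derivative t *\<^sub>R X (v s)) (at s within {0..1})"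
    unfolding flows_to_def closed_segment_eq_real_ivl by auto
  then show ?thesis
    using integral_curve_unique[OF C1_map_scaleR[OF C1, of t], of 1 u v] by auto
qed

lemma flow_eqI:
  fixes X :: "'a::euclidean_space \<Rightarrow> 'a"
  assumes "C1_map X" "flows_to X t x y"
  shows "flow X t x = y"
  unfolding flow_def using assms flows_to_unique by blast

text \<open>The field is autonomous, so a time shift of an integral curve is again one;
  \<open>s < r\<close> is allowed and gives the backward flow.\<close>

lemma flows_to_integral_curve:
  assumes \<gamma>: "\<And>s. s \<in> S \<Longrightarrow> (\<gamma> has_vector_derivative X (\<gamma> s)) (at s within S)"
    and S: "convex S" "r \<in> S" "s \<in> S"
  shows "flows_to X (s - r) (\<gamma> r) (\<gamma> s)"
proof -
  have img: "(\<lambda>t. t + r) ` closed_segment 0 (s - r) \<subseteq> S"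
    using closed_segment_subset[OF S(2,3,1)] closed_segment_translation[of r 0 "s - r"]
    by (simp add: add.commute)
  have "((\<lambda>t. \<gamma> (t + r)) has_vector_derivative X (\<gamma> (t + r))) (at t within closed_segment 0 (s - r))"
    if t: "t \<in> closed_segment 0 (s - r)" for t
  proof -
    have "((\<lambda>t. t + r) has_vector_derivative 1) (at t within closed_segment 0 (s - r))"
      by (auto intro!: derivative_eq_intros)
    moreover have "(\<gamma> has_vector_derivative X (\<gamma> (t + r)))
        (at (t + r) within (\<lambda>t. t + r) ` closed_segment 0 (s - r))"
      using img t by (intro has_vector_derivative_within_subset[OF \<gamma> img]) auto
    ultimately show ?thesis
      using vector_diff_chain_within by (fastforce simp: comp_def)
  qed
  then show ?thesis unfolding flows_to_def
    by (intro exI[of _ "\<lambda>t. \<gamma> (t + r)"]) auto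
qed

text \<open>Existence time and speed bound are uniform over all starting points near
  \<open>x\<close>. This controls a second flow whose starting point moves along the first.\<close>

lemma local_flow:
  fixes X :: "'a::euclidean_space \<Rightarrow> 'a"
  assumes C1: "C1_map X"
  obtains a b M where "a > 0" "b > 0" "M \<ge> 0"
    "\<And>z. z \<in> cball x b \<Longrightarrow> flow X 0 z = z"
    "\<And>z t. z \<in> cball x b \<Longrightarrow> t \<in> {-a..a} \<Longrightarrow>
      ((\<lambda>t. flow X t z) has_vector_derivative X (flow X t z)) (at t within {-a..a})"
    "\<And>z t. z \<in> cball x b \<Longrightarrow> t \<in> {-a..a} \<Longrightarrow> norm (flow X t z - z) \<le> M * \<bar>t\<bar>"
proof -
  obtain L where L: "L \<ge> 0"
    "\<And>y z. y \<in> cball x 2 \<Longrightarrow> z \<in> cball x 2 \<Longrightarrow> norm (X y - X z) \<le> L * norm (y - z)"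
    using C1_map_Lipschitz_on_cball[OF C1] by metis
  have "bounded (X ` cball x 2)"
    by (intro compact_imp_bounded compact_continuous_image C1_map_continuous_on C1 compact_cball)
  then obtain M where M: "M > 0" "\<And>y. y \<in> cball x 2 \<Longrightarrow> norm (X y) \<le> M"
    by (auto simp: bounded_pos)
  \<comment> \<open>Composing with the 1-Lipschitz projection onto the ball makes the field globally Lipschitz;
    the curves are too short to leave the ball, so they do not see the modification.\<close>
  define P where "P = closest_point (cball x 2)"
  have P: "P z \<in> cball x 2" for z
    unfolding P_def by (rule closest_point_in_set) (simp_all add: cball_eq_empty)
  have P_id: "P z = z" if "z \<in> cball x 2" for z
    unfolding P_def using that by (rule closest_point_self)
  have lip: "norm (X (P y) - X (P z)) \<le> L * norm (y - z)" for y z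
  proof -
    have "norm (X (P y) - X (P z)) \<le> L * norm (P y - P z)"
      by (rule L(2)[OF P P])
    also have "\<dots> \<le> L * norm (y - z)"
      using closest_point_lipschitz[of "cball x 2" y z] L(1)
      by (intro mult_left_mono) (auto simp: P_def dist_norm)
    finally show ?thesis .
  qed
  \<comment> \<open>The first bound makes the Picard operator a contraction; the second limits the
    displacement to 1, so a curve from the ball of radius 1 stays in the ball of radius 2.\<close>
  define a where "a = min (1 / (4 * (L + 1))) (1 / M)"
  have a: "a > 0" "3 * a * L < 1" "M * a \<le> 1"
  proof -
    show "a > 0" using L(1) M(1) by (auto simp: a_def)
    have "a * (4 * (L + 1)) \<le> 1"
      using L(1) pos_le_divide_eq[of "4 * (L + 1)" a 1] by (simp add: a_def)
    then show "3 * a * L < 1"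
      using \<open>a > 0\<close> L(1) mult_nonneg_nonneg[of a L] by (simp add: algebra_simps)
    show "M * a \<le> 1"
      using M(1) pos_le_divide_eq[of M a 1] by (simp add: a_def mult.commute)
  qed
  have curve: "\<exists>\<gamma>. \<gamma> 0 = z \<and> (\<forall>t\<in>{-a..a}. (\<gamma> has_vector_derivative X (\<gamma> t)) (at t within {-a..a})
      \<and> norm (\<gamma> t - z) \<le> M * \<bar>t\<bar> \<and> flow X t z = \<gamma> t)" if z: "z \<in> cball x 1" for z
  proof -
    obtain \<gamma> where \<gamma>: "\<gamma> 0 = z"
      "\<And>t. t \<in> {-a..a} \<Longrightarrow> (\<gamma> has_vector_derivative X (P (\<gamma> t))) (at t within {-a..a})"
      using Picard_Lindeloef_global[of "\<lambda>z. X (P z)" L a z] lip L(1) a by auto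
    have near: "norm (\<gamma> t - z) \<le> M * \<bar>t\<bar>" if "t \<in> {-a..a}" for t
      using has_vector_derivative_norm_bound[OF \<gamma>(2) M(2)[OF P], of 0 t] that a(1) \<gamma>(1) by auto
    have "\<gamma> t \<in> cball x 2" if "t \<in> {-a..a}" for t
    proof -
      have "M * \<bar>t\<bar> \<le> M * a" using that M(1) by (intro mult_left_mono) auto
      then have "dist (\<gamma> t) z \<le> 1" using near[OF that] a(3) by (simp add: dist_norm)
      then show ?thesis using z dist_triangle[of x "\<gamma> t" z] by (simp add: dist_commute)
    qed
    then have \<gamma>X: "(\<gamma> has_vector_derivative X (\<gamma> t)) (at t within {-a..a})" if "t \<in> {-a..a}" for t
      using \<gamma>(2)[OF that] that by (simp add: P_id)
    then have "flow X t z = \<gamma> t" if "t \<in> {-a..a}" for t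
      using flows_to_integral_curve[of "{-a..a}" \<gamma> X 0 t, OF \<gamma>X] that a(1) \<gamma>(1)
      by (intro flow_eqI[OF C1]) auto
    then show ?thesis using \<gamma>(1) \<gamma>X near by blast
  qed
  show thesis
  proof (rule that[OF a(1) zero_less_one, of M])
    show "M \<ge> 0" using M(1) by simp
    fix z assume "z \<in> cball x 1"
    then obtain \<gamma> where \<gamma>: "\<gamma> 0 = z" "\<And>t. t \<in> {-a..a} \<Longrightarrow>
        (\<gamma> has_vector_derivative X (\<gamma> t)) (at t within {-a..a})"
        "\<And>t. t \<in> {-a..a} \<Longrightarrow> norm (\<gamma> t - z) \<le> M * \<bar>t\<bar>" "\<And>t. t \<in> {-a..a} \<Longrightarrow> flow X t z = \<gamma> t"
      using curve by blast
    show "flow X 0 z = z" using \<gamma>(1) \<gamma>(4)[of 0] a(1) by simp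
    fix t assume t: "t \<in> {-a..a}"
    show "((\<lambda>t. flow X t z) has_vector_derivative X (flow X t z)) (at t within {-a..a})"
      unfolding \<gamma>(4)[OF t]
      by (rule has_vector_derivative_transform[OF t _ \<gamma>(2)[OF t]]) (simp add: \<gamma>(4))
    show "norm (flow X t z - z) \<le> M * \<bar>t\<bar>" using \<gamma>(3,4) t by simp
  qed
qed

lemma local_flow_chain:
  fixes X Y :: "'a::euclidean_space \<Rightarrow> 'a"
  assumes X: "C1_map X" and Y: "C1_map Y"
  obtains a K where "a > 0" "K \<ge> 0" "flow X 0 x = x"
    "\<And>s. s \<in> {0..a} \<Longrightarrow>
      ((\<lambda>s. flow X s x) has_vector_derivative X (flow X s x)) (at s within {0..a})"
    "\<And>s. s \<in> {0..a} \<Longrightarrow> flow Y 0 (flow X s x) = flow X s x"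
    "\<And>s t. s \<in> {0..a} \<Longrightarrow> t \<in> {0..a} \<Longrightarrow>
      ((\<lambda>t. flow Y t (flow X s x)) has_vector_derivative Y (flow Y t (flow X s x))) (at t within {0..a})"
    "\<And>s t. s \<in> {0..a} \<Longrightarrow> t \<in> {0..a} \<Longrightarrow> norm (flow Y t (flow X s x) - x) \<le> K * (s + t)"
proof -
  obtain a b M where X: "a > 0" "b > 0" "M \<ge> 0"
    "\<And>z. z \<in> cball x b \<Longrightarrow> flow X 0 z = z"
    "\<And>z t. z \<in> cball x b \<Longrightarrow> t \<in> {-a..a} \<Longrightarrow>
      ((\<lambda>t. flow X t z) has_vector_derivative X (flow X t z)) (at t within {-a..a})"
    "\<And>z t. z \<in> cball x b \<Longrightarrow> t \<in> {-a..a} \<Longrightarrow> norm (flow X t z - z) \<le> M * \<bar>t\<bar>"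
    using local_flow[OF X, where x = x] by blast
  obtain a' b' M' where Y: "a' > 0" "b' > 0" "M' \<ge> 0"
    "\<And>z. z \<in> cball x b' \<Longrightarrow> flow Y 0 z = z"
    "\<And>z t. z \<in> cball x b' \<Longrightarrow> t \<in> {-a'..a'} \<Longrightarrow>
      ((\<lambda>t. flow Y t z) has_vector_derivative Y (flow Y t z)) (at t within {-a'..a'})"
    "\<And>z t. z \<in> cball x b' \<Longrightarrow> t \<in> {-a'..a'} \<Longrightarrow> norm (flow Y t z - z) \<le> M' * \<bar>t\<bar>"
    using local_flow[OF Y, where x = x] by blast
  \<comment> \<open>Besides the two existence times, the choice of \<open>c\<close> keeps the
    \<open>X\<close>-curve, which moves by at most \<open>M * s\<close>, inside the ball where the
    flow of \<open>Y\<close> is controlled; the 1 in \<open>M + 1\<close> covers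
    \<open>M = 0\<close>.\<close>
  define c where "c = min (min a a') (b' / (M + 1))"
  have c: "c > 0" "c \<le> a" "c \<le> a'" "c * (M + 1) \<le> b'"
    using X(1-3) Y(1-3) pos_le_divide_eq[of "M + 1" c b'] by (auto simp: c_def)
  have near: "norm (flow X s x - x) \<le> M * s" if "s \<in> {0..c}" for s
    using X(6)[of x s] X(2) that c by simp
  have in_b': "flow X s x \<in> cball x b'" if s: "s \<in> {0..c}" for s
  proof -
    have "M * s \<le> (M + 1) * c" using s X(3) c(1) by (intro mult_mono) auto
    then show ?thesis using near[OF s] c(4) by (simp add: dist_norm norm_minus_commute mult.commute)
  qed
  show thesis
  proof (rule that[of c "max M M'"])
    show "c > 0" by fact
    show "max M M' \<ge> 0" using X(3) by simp
    show "flow X 0 x = x" using X(2,4) by simp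
    fix s assume s: "s \<in> {0..c}"
    show "((\<lambda>s. flow X s x) has_vector_derivative X (flow X s x)) (at s within {0..c})"
      using X(5)[of x s] X(2) s c by (auto intro: has_vector_derivative_within_subset)
    show "flow Y 0 (flow X s x) = flow X s x" using Y(4) in_b'[OF s] by simp
    fix t assume t: "t \<in> {0..c}"
    show "((\<lambda>t. flow Y t (flow X s x)) has_vector_derivative Y (flow Y t (flow X s x))) (at t within {0..c})"
      using Y(5)[OF in_b'[OF s], of t] t c by (auto intro: has_vector_derivative_within_subset)
    have "norm (flow Y t (flow X s x) - flow X s x) \<le> M' * t"
      using Y(6)[OF in_b'[OF s], of t] t c by simp
    also have "\<dots> \<le> max M M' * t"
      using t by (intro mult_right_mono) auto
    finally have *: "norm (flow Y t (flow X s x) - flow X s x) \<le> max M M' * t" .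
    have "M * s \<le> max M M' * s" using s by (intro mult_right_mono) auto
    then have "norm (flow X s x - x) \<le> max M M' * s" using near[OF s] by simp
    with * show "norm (flow Y t (flow X s x) - x) \<le> max M M' * (s + t)"
      using norm_triangle_ineq[of "flow Y t (flow X s x) - flow X s x" "flow X s x - x"]
      by (simp add: distrib_left)
  qed
qed

section \<open>Lie derivatives\<close>

lemma lie_quotient_tendsto:
  "lie_differentiable X g x \<Longrightarrow> (lie_quotient X g x \<longlongrightarrow> lie_deriv X g x) (at 0)"
  unfolding lie_differentiable_def lie_deriv_def
  by (metis tendsto_Lim trivial_limit_at)

lemma lie_deriv_eqI: "(lie_quotient X g x \<longlongrightarrow> D) (at 0) \<Longrightarrow> lie_deriv X g x = D"
  unfolding lie_deriv_def by (simp add: tendsto_Lim)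

lemma lie_deriv_diff:
  assumes "lie_differentiable X g x" "lie_differentiable X h x"
  shows "lie_deriv X (\<lambda>z. g z - h z) x = lie_deriv X g x - lie_deriv X h x"
proof (rule lie_deriv_eqI)
  have "lie_quotient X (\<lambda>z. g z - h z) x = (\<lambda>t. lie_quotient X g x t - lie_quotient X h x t)"
    by (simp add: lie_quotient_def algebra_simps)
  then show "(lie_quotient X (\<lambda>z. g z - h z) x \<longlongrightarrow> lie_deriv X g x - lie_deriv X h x) (at 0)"
    using assms by (auto intro: tendsto_diff lie_quotient_tendsto)
qed

text \<open>By uniqueness the flow from \<open>\<gamma> s\<close> for time \<open>r - s\<close> ends
  at \<open>\<gamma> r\<close>, so the Lie quotient is the difference quotient of \<open>g\<close>
  along the curve. A function with Lie derivatives thus becomes a differentiable function of one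
  real variable, to which Taylor's formula applies.\<close>

lemma has_vector_derivative_lie_deriv:
  fixes X :: "'a::euclidean_space \<Rightarrow> 'a"
  assumes C1: "C1_map X"
    and \<gamma>: "\<And>s. s \<in> S \<Longrightarrow> (\<gamma> has_vector_derivative X (\<gamma> s)) (at s within S)"
    and S: "convex S" "s \<in> S"
    and diff: "lie_differentiable X g (\<gamma> s)"
  shows "((\<lambda>r. g (\<gamma> r)) has_vector_derivative lie_deriv X g (\<gamma> s)) (at s within S)"
  unfolding has_vector_derivative_iff_tendsto
proof (rule Lim_transform_eventually)
  have "filterlim (\<lambda>r. r - s) (at 0) (at s within S)"
    by (auto simp: filterlim_at eventually_at_filter intro!: tendsto_eq_intros)
  then show "((\<lambda>r. lie_quotient X g (\<gamma> s) (r - s)) \<longlongrightarrow> lie_deriv X g (\<gamma> s)) (at s within S)"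
    by (rule filterlim_compose[OF lie_quotient_tendsto[OF diff]])
  have "lie_quotient X g (\<gamma> s) (r - s) = (1 / (r - s)) *\<^sub>R (g (\<gamma> r) - g (\<gamma> s))" if "r \<in> S" for r
    unfolding lie_quotient_def
    using flow_eqI[OF C1 flows_to_integral_curve[of S \<gamma> X s r, OF \<gamma>]] S that by auto
  then show "\<forall>\<^sub>F r in at s within S.
      lie_quotient X g (\<gamma> s) (r - s) = (1 / (r - s)) *\<^sub>R (g (\<gamma> r) - g (\<gamma> s))"
    by (auto simp: eventually_at_filter)
qed

text \<open>Chain rule along the flow: on differentiable functions the Lie derivative is the usual
  directional derivative.\<close>

lemma has_derivative_lie_quotient:
  fixes X :: "'a::euclidean_space \<Rightarrow> 'a"
  assumes C1: "C1_map X" and g: "(g has_derivative D) (at x)"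
  shows "(lie_quotient X g x \<longlongrightarrow> D (X x)) (at 0)"
proof -
  obtain a where X: "a > 0" "flow X 0 x = x"
    "\<And>t. t \<in> {-a..a} \<Longrightarrow>
      ((\<lambda>t. flow X t x) has_vector_derivative X (flow X t x)) (at t within {-a..a})"
    by (rule local_flow[OF C1, where x = x]) auto
  have "at 0 within {-a..a} = at 0"
    using X(1) by (simp add: at_within_Icc_at)
  with X(2) X(3)[of 0] X(1) have "((\<lambda>t. flow X t x) has_vector_derivative X x) (at 0)"
    by simp
  moreover have "(g has_derivative D) (at (flow X 0 x))" using g X(2) by simp
  ultimately have "((g \<circ> (\<lambda>t. flow X t x)) has_vector_derivative D (X x)) (at 0)"
    by (intro vector_derivative_diff_chain_within) (auto intro: has_derivative_at_withinI)
  then show ?thesis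
    unfolding has_vector_derivative_iff_tendsto lie_quotient_def
    by (simp add: X(2) comp_def)
qed

section \<open>Second order expansion along flows\<close>

lemma Taylor_second_order_bound:
  fixes u :: "real \<Rightarrow> 'a::real_normed_vector"
  assumes u: "\<And>s. s \<in> {0..t} \<Longrightarrow> (u has_vector_derivative u' s) (at s within {0..t})"
    and u': "\<And>s. s \<in> {0..t} \<Longrightarrow> (u' has_vector_derivative u'' s) (at s within {0..t})"
    and bound: "\<And>s. s \<in> {0..t} \<Longrightarrow> norm (u'' s - c) \<le> e"
    and t: "t \<ge> 0"
  shows "norm (u t - u 0 - t *\<^sub>R u' 0 - (t\<^sup>2 / 2) *\<^sub>R c) \<le> e * t\<^sup>2"
proof -
  \<comment> \<open>Remainders of \<open>u'\<close> after its affine model and of \<open>u\<close>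
    after its quadratic model. The mean value inequality bounds \<open>v\<close> by
    \<open>e * t\<close> and then the increment of \<open>w\<close> by
    \<open>e * t\<^sup>2\<close>.\<close>
  define v where "v s = u' s - u' 0 - s *\<^sub>R c" for s
  define w where "w s = u s - s *\<^sub>R u' 0 - (s\<^sup>2 / 2) *\<^sub>R c" for s
  have v: "(v has_vector_derivative u'' s - c) (at s within {0..t})" if "s \<in> {0..t}" for s
    unfolding v_def[abs_def] using u'[OF that] by (auto intro!: derivative_eq_intros)
  have w: "(w has_vector_derivative v s) (at s within {0..t})" if "s \<in> {0..t}" for s
    unfolding w_def[abs_def] v_def using u[OF that]
    by (auto intro!: derivative_eq_intros)
  have "norm (v s) \<le> e * t" if s: "s \<in> {0..t}" for s
  proof -
    have "norm (v s - v 0) \<le> e * \<bar>s - 0\<bar>"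
      using v bound s t by (intro has_vector_derivative_norm_bound[of "{0..t}"]) auto
    also have "\<dots> \<le> e * t"
      using s order_trans[OF norm_ge_zero bound[OF s]] by (intro mult_left_mono) auto
    finally show ?thesis by (simp add: v_def)
  qed
  then have "norm (w t - w 0) \<le> (e * t) * \<bar>t - 0\<bar>"
    using w t by (intro has_vector_derivative_norm_bound[of "{0..t}" w v]) auto
  then show ?thesis using t by (simp add: w_def power2_eq_square algebra_simps)
qed

text \<open>The curve \<open>u t\<close> may change with the final time \<open>t\<close>, because
  the second leg of a chain starts at a point that depends on the duration of the first.\<close>

lemma Taylor_second_order_tendsto:
  fixes u u' u'' :: "real \<Rightarrow> real \<Rightarrow> 'a::real_normed_vector"
  assumes "\<And>e. e > 0 \<Longrightarrow> \<forall>\<^sub>F t in at_right 0. \<forall>s\<in>{0..t}.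
      (u t has_vector_derivative u' t s) (at s within {0..t}) \<and>
      (u' t has_vector_derivative u'' t s) (at s within {0..t}) \<and> norm (u'' t s - c) \<le> e"
  shows "((\<lambda>t. (1 / t\<^sup>2) *\<^sub>R (u t t - u t 0 - t *\<^sub>R u' t 0)) \<longlongrightarrow> (1 / 2) *\<^sub>R c) (at_right 0)"
proof (rule tendstoI)
  fix e :: real assume "e > 0"
  then have "\<forall>\<^sub>F t in at_right 0. \<forall>s\<in>{0..t}.
      (u t has_vector_derivative u' t s) (at s within {0..t}) \<and>
      (u' t has_vector_derivative u'' t s) (at s within {0..t}) \<and> norm (u'' t s - c) \<le> e / 2"
    by (intro assms) simp
  then show "\<forall>\<^sub>F t in at_right 0.
      dist ((1 / t\<^sup>2) *\<^sub>R (u t t - u t 0 - t *\<^sub>R u' t 0)) ((1 / 2) *\<^sub>R c) < e"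
    using eventually_at_right_less[of 0]
  proof eventually_elim
    case (elim t)
    have "norm (u t t - u t 0 - t *\<^sub>R u' t 0 - (t\<^sup>2 / 2) *\<^sub>R c) \<le> (e / 2) * t\<^sup>2"
      using elim by (intro Taylor_second_order_bound[where u'' = "u'' t"]) auto
    moreover have "(1 / t\<^sup>2) *\<^sub>R (u t t - u t 0 - t *\<^sub>R u' t 0) - (1 / 2) *\<^sub>R c
        = (1 / t\<^sup>2) *\<^sub>R (u t t - u t 0 - t *\<^sub>R u' t 0 - (t\<^sup>2 / 2) *\<^sub>R c)"
      using elim(2) by (simp add: scaleR_diff_right)
    ultimately have "dist ((1 / t\<^sup>2) *\<^sub>R (u t t - u t 0 - t *\<^sub>R u' t 0)) ((1 / 2) *\<^sub>R c) \<le> e / 2"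
      using elim(2) unfolding dist_norm by (simp add: pos_divide_le_eq)
    with \<open>e > 0\<close> show ?case by simp
  qed
qed

text \<open>The form of continuity that the control distance provides: a d-Lipschitz function may
  jump between Euclidean-close points that no chain of flows joins, but not along short chains from
  \<open>x\<close>. The flow of \<open>X\<close> acts first.\<close>

definition chain_continuous ::
    "('a::real_normed_vector \<Rightarrow> 'a) \<Rightarrow> ('a \<Rightarrow> 'a) \<Rightarrow> ('a \<Rightarrow> 'b::real_normed_vector) \<Rightarrow> 'a \<Rightarrow> bool" where
  "chain_continuous X Y h x \<longleftrightarrow>
     (\<forall>e>0. \<exists>d>0. \<forall>s\<in>{0..d}. \<forall>t\<in>{0..d}. norm (h (flow Y t (flow X s x)) - h x) \<le> e)"

lemma isCont_imp_chain_continuous: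
  fixes X Y :: "'a::euclidean_space \<Rightarrow> 'a"
  assumes C1: "C1_map X" "C1_map Y" and h: "isCont h x"
  shows "chain_continuous X Y h x"
  unfolding chain_continuous_def
proof (intro allI impI)
  fix e :: real assume "e > 0"
  then obtain r where r: "r > 0" "\<And>y. norm (y - x) < r \<Longrightarrow> norm (h y - h x) < e"
    using h unfolding continuous_at_eps_delta dist_norm by metis
  obtain a K where aK: "a > 0" "K \<ge> 0"
    "\<And>s t. s \<in> {0..a} \<Longrightarrow> t \<in> {0..a} \<Longrightarrow> norm (flow Y t (flow X s x) - x) \<le> K * (s + t)"
    by (rule local_flow_chain[OF C1, of x]) blast
  define d where "d = min a (r / (2 * K + 1))"
  have d: "d > 0" "d \<le> a" "d * (2 * K + 1) \<le> r"
    using aK(1,2) r(1) pos_le_divide_eq[of "2 * K + 1" d r] by (auto simp: d_def)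
  have "norm (h (flow Y t (flow X s x)) - h x) \<le> e" if st: "s \<in> {0..d}" "t \<in> {0..d}" for s t
  proof -
    have "norm (flow Y t (flow X s x) - x) \<le> K * (s + t)"
      using st d(2) by (intro aK(3)) auto
    also have "\<dots> \<le> K * (d + d)"
      using st aK(2) by (intro mult_left_mono) auto
    also have "\<dots> < r" using d(1,3) by (simp add: algebra_simps)
    finally show ?thesis using r(2) less_imp_le by blast
  qed
  with d(1) show "\<exists>d>0. \<forall>s\<in>{0..d}. \<forall>t\<in>{0..d}. norm (h (flow Y t (flow X s x)) - h x) \<le> e"
    by blast
qed

lemma chain_continuous_tendsto:
  assumes "chain_continuous X Y h x"
  shows "((\<lambda>t. h (flow Y t (flow X t x))) \<longlongrightarrow> h x) (at_right 0)"
proof (rule tendstoI)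
  fix e :: real assume "e > 0"
  then obtain d where d: "d > 0" "\<forall>s\<in>{0..d}. \<forall>t\<in>{0..d}. norm (h (flow Y t (flow X s x)) - h x) \<le> e / 2"
    using assms unfolding chain_continuous_def by (meson half_gt_zero)
  from eventually_at_right_less[of 0] eventually_at_right_real[OF d(1)]
  show "\<forall>\<^sub>F t in at_right 0. dist (h (flow Y t (flow X t x))) (h x) < e"
  proof eventually_elim
    case (elim t)
    then have "norm (h (flow Y t (flow X t x)) - h x) \<le> e / 2" using d(2) by auto
    then show ?case using \<open>e > 0\<close> by (simp add: dist_norm)
  qed
qed

text \<open>The increment telescopes into a second order expansion along \<open>X\<close> from
  \<open>x\<close>, one along \<open>Y\<close> from the moving point \<open>flow X t x\<close>, and
  the change of the linear coefficient \<open>lie_deriv Y g\<close> between these two points. The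
  last part yields the mixed term, with the derivative along the first flow outermost.\<close>

lemma flow_chain_expansion:
  fixes X Y :: "'a::euclidean_space \<Rightarrow> 'a" and g :: "'a \<Rightarrow> 'b::real_normed_vector"
  assumes C1: "C1_map X" "C1_map Y"
    and Xg: "\<And>z. lie_differentiable X g z" and XXg: "\<And>z. lie_differentiable X (lie_deriv X g) z"
    and Yg: "\<And>z. lie_differentiable Y g z" and YYg: "\<And>z. lie_differentiable Y (lie_deriv Y g) z"
    and XYg: "\<And>z. lie_differentiable X (lie_deriv Y g) z"
    and cX: "chain_continuous Y X (lie_deriv X (lie_deriv X g)) x"
    and cY: "chain_continuous X Y (lie_deriv Y (lie_deriv Y g)) x"
  shows "((\<lambda>t. (1 / t\<^sup>2) *\<^sub>R (g (flow Y t (flow X t x)) - g x - t *\<^sub>R (lie_deriv X g x + lie_deriv Y g x)))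
      \<longlongrightarrow> (1 / 2) *\<^sub>R lie_deriv X (lie_deriv X g) x + lie_deriv X (lie_deriv Y g) x
        + (1 / 2) *\<^sub>R lie_deriv Y (lie_deriv Y g) x) (at_right 0)"
proof -
  let ?p = "\<lambda>s. flow X s x" and ?q = "\<lambda>s t. flow Y t (flow X s x)"
  obtain a where a: "a > 0" "?p 0 = x"
    "\<And>s. s \<in> {0..a} \<Longrightarrow> (?p has_vector_derivative X (?p s)) (at s within {0..a})"
    "\<And>s. s \<in> {0..a} \<Longrightarrow> ?q s 0 = ?p s"
    "\<And>s t. s \<in> {0..a} \<Longrightarrow> t \<in> {0..a} \<Longrightarrow>
      (?q s has_vector_derivative Y (?q s t)) (at t within {0..a})"
    by (rule local_flow_chain[OF C1, of x]) blast
  have Y0: "flow Y 0 x = x" using a(1,2) a(4)[of 0] by simp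
  have p: "(?p has_vector_derivative X (?p s)) (at s within {0..t})"
    if "t \<le> a" "s \<in> {0..t}" for s t
    by (rule has_vector_derivative_within_subset[OF a(3)]) (use that in auto)
  have q: "(?q t has_vector_derivative Y (?q t s)) (at s within {0..t})"
    if "t \<le> a" "s \<in> {0..t}" for s t
    by (rule has_vector_derivative_within_subset[OF a(5)]) (use that in auto)
  have "((\<lambda>t. (1 / t\<^sup>2) *\<^sub>R (g (?p t) - g (?p 0) - t *\<^sub>R lie_deriv X g (?p 0)))
      \<longlongrightarrow> (1 / 2) *\<^sub>R lie_deriv X (lie_deriv X g) x) (at_right 0)"
  proof (rule Taylor_second_order_tendsto[where u = "\<lambda>t s. g (?p s)" and u' = "\<lambda>t s. lie_deriv X g (?p s)"
        and u'' = "\<lambda>t s. lie_deriv X (lie_deriv X g) (?p s)"])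
    fix e :: real assume "e > 0"
    then obtain d where d: "d > 0"
      "\<forall>s\<in>{0..d}. \<forall>t\<in>{0..d}. norm (lie_deriv X (lie_deriv X g) (flow X t (flow Y s x))
        - lie_deriv X (lie_deriv X g) x) \<le> e"
      using cX unfolding chain_continuous_def by blast
    have cont: "norm (lie_deriv X (lie_deriv X g) (?p s) - lie_deriv X (lie_deriv X g) x) \<le> e"
      if "s \<in> {0..d}" for s
      \<comment> \<open>In \<open>cX\<close> the flow of \<open>Y\<close> acts first; giving it time
        0 leaves a pure \<open>X\<close>-curve, by \<open>Y0\<close>.\<close>
      using d(2)[THEN bspec, of 0] that d(1) Y0 by auto
    have "min a d > 0" using a(1) d(1) by simp
    from eventually_at_right_real[OF this]
    show "\<forall>\<^sub>F t in at_right 0. \<forall>s\<in>{0..t}.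
        ((\<lambda>s. g (?p s)) has_vector_derivative lie_deriv X g (?p s)) (at s within {0..t}) \<and>
        ((\<lambda>s. lie_deriv X g (?p s)) has_vector_derivative lie_deriv X (lie_deriv X g) (?p s))
          (at s within {0..t}) \<and>
        norm (lie_deriv X (lie_deriv X g) (?p s) - lie_deriv X (lie_deriv X g) x) \<le> e"
    proof eventually_elim
      case (elim t)
      then have "t \<le> a" by simp
      then show ?case using elim
        by (auto intro!: has_vector_derivative_lie_deriv[OF C1(1) p] Xg XXg cont)
    qed
  qed
  \<comment> \<open>The start \<open>?p t\<close> of this leg varies with \<open>t\<close>, so the
    bound must hold jointly in both times, as \<open>cY\<close> provides.\<close>
  moreover have "((\<lambda>t. (1 / t\<^sup>2) *\<^sub>R (g (?q t t) - g (?q t 0) - t *\<^sub>R lie_deriv Y g (?q t 0)))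
      \<longlongrightarrow> (1 / 2) *\<^sub>R lie_deriv Y (lie_deriv Y g) x) (at_right 0)"
  proof (rule Taylor_second_order_tendsto[where u = "\<lambda>t s. g (?q t s)"
        and u' = "\<lambda>t s. lie_deriv Y g (?q t s)" and u'' = "\<lambda>t s. lie_deriv Y (lie_deriv Y g) (?q t s)"])
    fix e :: real assume "e > 0"
    then obtain d where d: "d > 0"
      "\<forall>s\<in>{0..d}. \<forall>t\<in>{0..d}. norm (lie_deriv Y (lie_deriv Y g) (?q s t)
        - lie_deriv Y (lie_deriv Y g) x) \<le> e"
      using cY unfolding chain_continuous_def by blast
    have "min a d > 0" using a(1) d(1) by simp
    from eventually_at_right_real[OF this]
    show "\<forall>\<^sub>F t in at_right 0. \<forall>s\<in>{0..t}.
        ((\<lambda>s. g (?q t s)) has_vector_derivative lie_deriv Y g (?q t s)) (at s within {0..t}) \<and>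
        ((\<lambda>s. lie_deriv Y g (?q t s)) has_vector_derivative lie_deriv Y (lie_deriv Y g) (?q t s))
          (at s within {0..t}) \<and>
        norm (lie_deriv Y (lie_deriv Y g) (?q t s) - lie_deriv Y (lie_deriv Y g) x) \<le> e"
    proof eventually_elim
      case (elim t)
      then have "t \<le> a" by simp
      then show ?case using elim d(2)
        by (auto intro!: has_vector_derivative_lie_deriv[OF C1(2) q] Yg YYg)
    qed
  qed
  moreover have "((\<lambda>t. (1 / t) *\<^sub>R (lie_deriv Y g (?p t) - lie_deriv Y g x))
      \<longlongrightarrow> lie_deriv X (lie_deriv Y g) x) (at_right 0)"
  proof -
    have "((\<lambda>s. lie_deriv Y g (?p s)) has_vector_derivative lie_deriv X (lie_deriv Y g) (?p 0))
        (at 0 within {0..a})"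
      using a(1) by (intro has_vector_derivative_lie_deriv[OF C1(1) a(3)] XYg) auto
    then show ?thesis
      using a(1,2) by (simp add: has_vector_derivative_iff_tendsto at_within_Icc_at_right)
  qed
  ultimately have "((\<lambda>t. (1 / t\<^sup>2) *\<^sub>R (g (?p t) - g (?p 0) - t *\<^sub>R lie_deriv X g (?p 0))
      + (1 / t) *\<^sub>R (lie_deriv Y g (?p t) - lie_deriv Y g x)
      + (1 / t\<^sup>2) *\<^sub>R (g (?q t t) - g (?q t 0) - t *\<^sub>R lie_deriv Y g (?q t 0)))
      \<longlongrightarrow> (1 / 2) *\<^sub>R lie_deriv X (lie_deriv X g) x + lie_deriv X (lie_deriv Y g) x
        + (1 / 2) *\<^sub>R lie_deriv Y (lie_deriv Y g) x) (at_right 0)"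
    by (intro tendsto_add)
  then show ?thesis
  proof (rule Lim_transform_eventually)
    show "\<forall>\<^sub>F t in at_right 0. (1 / t\<^sup>2) *\<^sub>R (g (?p t) - g (?p 0) - t *\<^sub>R lie_deriv X g (?p 0))
      + (1 / t) *\<^sub>R (lie_deriv Y g (?p t) - lie_deriv Y g x)
      + (1 / t\<^sup>2) *\<^sub>R (g (?q t t) - g (?q t 0) - t *\<^sub>R lie_deriv Y g (?q t 0))
      = (1 / t\<^sup>2) *\<^sub>R (g (?q t t) - g x - t *\<^sub>R (lie_deriv X g x + lie_deriv Y g x))"
      using eventually_at_right_real[OF a(1)]
    proof eventually_elim
      case (elim t)
      \<comment> \<open>The linear term of the second leg already carries a factor \<open>t\<close>,
        so moving its coefficient back to \<open>x\<close> is a first order effect, divided by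
        \<open>t\<close> only.\<close>
      have "(1 / t) *\<^sub>R (lie_deriv Y g (?p t) - lie_deriv Y g x)
          = (1 / t\<^sup>2) *\<^sub>R (t *\<^sub>R (lie_deriv Y g (?p t) - lie_deriv Y g x))"
        using elim by (simp add: power2_eq_square)
      then show ?case
        using elim a(2) a(4)[of t]
        by (simp only: scaleR_add_right[symmetric]) (simp add: algebra_simps)
    qed
  qed
qed

text \<open>First order terms and pure second derivatives are symmetric in \<open>X\<close> and
  \<open>Y\<close>, so subtracting the expansions for the two orders of the flows leaves only the
  mixed derivatives.\<close>

lemma flow_commutator_tendsto:
  fixes X Y :: "'a::euclidean_space \<Rightarrow> 'a" and g :: "'a \<Rightarrow> 'b::real_normed_vector"
  assumes C1: "C1_map X" "C1_map Y"
    and Xg: "\<And>z. lie_differentiable X g z" and XXg: "\<And>z. lie_differentiable X (lie_deriv X g) z"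
    and Yg: "\<And>z. lie_differentiable Y g z" and YYg: "\<And>z. lie_differentiable Y (lie_deriv Y g) z"
    and XYg: "\<And>z. lie_differentiable X (lie_deriv Y g) z"
    and YXg: "\<And>z. lie_differentiable Y (lie_deriv X g) z"
    and cX: "chain_continuous Y X (lie_deriv X (lie_deriv X g)) x"
    and cY: "chain_continuous X Y (lie_deriv Y (lie_deriv Y g)) x"
  shows "((\<lambda>t. (1 / t\<^sup>2) *\<^sub>R (g (flow Y t (flow X t x)) - g (flow X t (flow Y t x))))
      \<longlongrightarrow> lie_deriv X (lie_deriv Y g) x - lie_deriv Y (lie_deriv X g) x) (at_right 0)"
  using tendsto_diff[OF flow_chain_expansion[OF C1 Xg XXg Yg YYg XYg cX cY]
      flow_chain_expansion[OF C1(2,1) Yg YYg Xg XXg YXg cY cX]]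
  by (simp add: scaleR_diff_right[symmetric] add.commute)

text \<open>Both end points move, so differentiability at \<open>x\<close> alone would not control
  the error relative to \<open>p t - q t\<close>; continuity of the derivative upgrades it to strict
  differentiability.\<close>

lemma C1_map_tendsto_increment:
  fixes g :: "'a::real_normed_vector \<Rightarrow> 'b::real_normed_vector"
  assumes C1: "C1_map g" and D: "(g has_derivative D) (at x)"
    and p: "(p \<longlongrightarrow> x) F" and q: "(q \<longlongrightarrow> x) F"
    and v: "((\<lambda>t. c t *\<^sub>R (p t - q t)) \<longlongrightarrow> v) F"
  shows "((\<lambda>t. c t *\<^sub>R (g (p t) - g (q t))) \<longlongrightarrow> D v) F"
proof -
  from C1 obtain g' where
    g': "\<And>x. (g has_derivative blinfun_apply (g' x)) (at x)" "continuous_on UNIV g'"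
    unfolding C1_map_def by blast
  have D_eq: "D = blinfun_apply (g' x)"
    using has_derivative_unique[OF D g'(1)] .
  have strict: "\<exists>d>0. \<forall>y\<in>ball x d. \<forall>z\<in>ball x d. norm (g y - g z - D (y - z)) \<le> e * norm (y - z)"
    if "e > 0" for e :: real
  proof -
    have "isCont g' x" using g'(2) by (simp add: continuous_on_eq_continuous_at)
    then obtain d where d: "d > 0" "\<And>y. dist y x < d \<Longrightarrow> dist (g' y) (g' x) < e"
      using \<open>e > 0\<close> unfolding continuous_at_eps_delta by blast
    \<comment> \<open>The map \<open>g - D\<close> has derivative \<open>g' w - g' x\<close>, which
      is small near \<open>x\<close>, so it is Lipschitz there with constant
      \<open>e\<close>.\<close>
    have "norm ((g y - D y) - (g z - D z)) \<le> e * norm (y - z)" if "y \<in> ball x d" "z \<in> ball x d" for y z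
    proof (rule differentiable_bound[where f' = "\<lambda>y. blinfun_apply (g' y - g' x)"])
      fix w assume w: "w \<in> ball x d"
      show "((\<lambda>y. g y - D y) has_derivative blinfun_apply (g' w - g' x)) (at w within ball x d)"
        unfolding D_eq minus_blinfun.rep_eq
        by (intro has_derivative_diff has_derivative_at_withinI[OF g'(1)]
            bounded_linear_imp_has_derivative blinfun.bounded_linear_right)
      show "onorm (blinfun_apply (g' w - g' x)) \<le> e"
        using d(2)[of w] w by (simp add: norm_blinfun.rep_eq[symmetric] dist_norm norm_minus_commute)
    qed (use that in auto)
    moreover have "(g y - D y) - (g z - D z) = g y - g z - D (y - z)" for y z
      using D by (simp add: has_derivative_def linear_diff bounded_linear.linear)
    ultimately show ?thesis using d(1) by (intro exI[of _ d]) simp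
  qed
  have "((\<lambda>t. c t *\<^sub>R (g (p t) - g (q t) - D (p t - q t))) \<longlongrightarrow> 0) F"
  proof (rule tendstoI)
    fix e :: real assume "e > 0"
    \<comment> \<open>Eventually \<open>c t *\<^sub>R (p t - q t)\<close> has norm below
      \<open>norm v + 1\<close>, so the error stays below \<open>e\<close>.\<close>
    define e' where "e' = e / (norm v + 1)"
    have e': "e' > 0" "e' * (norm v + 1) = e"
      using \<open>e > 0\<close> add_nonneg_pos[OF norm_ge_zero[of v] zero_less_one] by (simp_all add: e'_def)
    from strict[OF e'(1)] obtain d where d: "d > 0"
      "\<And>y z. y \<in> ball x d \<Longrightarrow> z \<in> ball x d \<Longrightarrow> norm (g y - g z - D (y - z)) \<le> e' * norm (y - z)"
      by blast
    have "\<forall>\<^sub>F t in F. norm (c t *\<^sub>R (p t - q t)) < norm v + 1"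
      using tendsto_norm[OF v] by (rule order_tendstoD) simp
    with tendstoD[OF p d(1)] tendstoD[OF q d(1)]
    show "\<forall>\<^sub>F t in F. dist (c t *\<^sub>R (g (p t) - g (q t) - D (p t - q t))) 0 < e"
    proof eventually_elim
      case (elim t)
      have "norm (c t *\<^sub>R (g (p t) - g (q t) - D (p t - q t))) \<le> \<bar>c t\<bar> * (e' * norm (p t - q t))"
        using elim d(2)[of "p t" "q t"] by (auto intro!: mult_left_mono simp: dist_commute)
      also have "\<dots> = e' * norm (c t *\<^sub>R (p t - q t))" by simp
      also have "\<dots> < e" using elim(3) e' mult_strict_left_mono by metis
      finally show ?case by simp
    qed
  qed
  moreover have "((\<lambda>t. D (c t *\<^sub>R (p t - q t))) \<longlongrightarrow> D v) F"
    using D v by (intro bounded_linear.tendsto[of D]) (auto dest: has_derivative_bounded_linear)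
  ultimately have "((\<lambda>t. c t *\<^sub>R (g (p t) - g (q t) - D (p t - q t)) + D (c t *\<^sub>R (p t - q t))) \<longlongrightarrow> 0 + D v) F"
    by (rule tendsto_add)
  moreover have "D (r *\<^sub>R y) = r *\<^sub>R D y" for r y
    using D by (simp add: has_derivative_def linear_cmul bounded_linear.linear)
  ultimately show ?thesis
    by (simp only: scaleR_add_right[symmetric] diff_add_cancel add_0_left)
qed

section \<open>The commutator formula for C1 functions\<close>

lemma
  fixes X :: "'a::euclidean_space \<Rightarrow> 'a" and g :: "'a \<Rightarrow> 'b::real_normed_vector"
  assumes X: "C1_map X" and g: "C1_map g"
  shows C1_map_lie_differentiable: "lie_differentiable X g x"
    and C1_map_isCont_lie_deriv: "isCont (lie_deriv X g) x"
proof -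
  from g obtain g' where
    g': "\<And>x. (g has_derivative blinfun_apply (g' x)) (at x)" "continuous_on UNIV g'"
    unfolding C1_map_def by blast
  \<comment> \<open>The explicit value of the limit gives existence at once, and continuity as soon
    as the Lie derivative is identified with it.\<close>
  have lim: "(lie_quotient X g x \<longlongrightarrow> g' x (X x)) (at 0)" for x
    by (rule has_derivative_lie_quotient[OF X g'(1)])
  show "lie_differentiable X g x"
    using lim unfolding lie_differentiable_def by blast
  have eq: "lie_deriv X g = (\<lambda>x. g' x (X x))"
    using lie_deriv_eqI[OF lim] by auto
  show "isCont (lie_deriv X g) x"
    unfolding eq using g'(2) C1_map_continuous_on[OF X, of UNIV]
    by (intro blinfun.isCont) (auto simp: continuous_on_eq_continuous_at)
qed

text \<open>The increment of \<open>g\<close> between the two end points, divided by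
  \<open>t\<^sup>2\<close>, has its limit computed twice: from the expansion of \<open>g\<close>,
  and from that of the end points combined with strict differentiability.\<close>

lemma lie_deriv_commutator:
  fixes X Y :: "'a::euclidean_space \<Rightarrow> 'a" and g :: "'a \<Rightarrow> 'b::real_normed_vector"
  assumes C1: "C1_map X" "C1_map Y" "C1_map g"
    and XXg: "\<And>z. lie_differentiable X (lie_deriv X g) z"
    and YYg: "\<And>z. lie_differentiable Y (lie_deriv Y g) z"
    and XYg: "\<And>z. lie_differentiable X (lie_deriv Y g) z"
    and YXg: "\<And>z. lie_differentiable Y (lie_deriv X g) z"
    and cX: "chain_continuous Y X (lie_deriv X (lie_deriv X g)) x"
    and cY: "chain_continuous X Y (lie_deriv Y (lie_deriv Y g)) x"
  shows "lie_deriv X (lie_deriv Y g) x - lie_deriv Y (lie_deriv X g) x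
    = vf_op (\<lambda>z. lie_deriv X Y z - lie_deriv Y X z) g x"
proof -
  \<comment> \<open>The Lie derivative of the identity along a C1 field is the field itself. So for
    the identity the mixed derivatives are \<open>lie_deriv X Y\<close> and
    \<open>lie_deriv Y X\<close>, and the regularity required by the expansion follows from
    C1.\<close>
  have id_lim: "(lie_quotient Z (\<lambda>z. z) z \<longlongrightarrow> Z z) (at 0)" if "C1_map Z" for Z :: "'a \<Rightarrow> 'a" and z
    using has_derivative_lie_quotient[OF that has_derivative_ident] .
  have id_diff: "lie_differentiable Z (\<lambda>z. z) z" if "C1_map Z" for Z :: "'a \<Rightarrow> 'a" and z
    using id_lim[OF that] unfolding lie_differentiable_def by blast
  have id_deriv: "lie_deriv Z (\<lambda>z. z) = Z" if "C1_map Z" for Z :: "'a \<Rightarrow> 'a"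
    using lie_deriv_eqI[OF id_lim[OF that]] by blast
  have "((\<lambda>t. (1 / t\<^sup>2) *\<^sub>R (flow Y t (flow X t x) - flow X t (flow Y t x)))
      \<longlongrightarrow> lie_deriv X Y x - lie_deriv Y X x) (at_right 0)"
    using flow_commutator_tendsto[OF C1(1,2), of "\<lambda>z. z" x] C1(1,2)
    by (simp add: id_deriv id_diff C1_map_lie_differentiable isCont_imp_chain_continuous
        C1_map_isCont_lie_deriv)
  moreover have "((\<lambda>t. flow Y t (flow X t x)) \<longlongrightarrow> x) (at_right 0)"
    "((\<lambda>t. flow X t (flow Y t x)) \<longlongrightarrow> x) (at_right 0)"
    using C1 by (auto intro!: chain_continuous_tendsto[where h = "\<lambda>z. z"] isCont_imp_chain_continuous)
  moreover have "(g has_derivative frechet_derivative g (at x)) (at x)"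
    using C1(3) unfolding C1_map_def
    by (metis differentiableI frechet_derivative_works)
  ultimately have "((\<lambda>t. (1 / t\<^sup>2) *\<^sub>R (g (flow Y t (flow X t x)) - g (flow X t (flow Y t x))))
      \<longlongrightarrow> vf_op (\<lambda>z. lie_deriv X Y z - lie_deriv Y X z) g x) (at_right 0)"
    unfolding vf_op_def by (intro C1_map_tendsto_increment[OF C1(3)])
  moreover have "((\<lambda>t. (1 / t\<^sup>2) *\<^sub>R (g (flow Y t (flow X t x)) - g (flow X t (flow Y t x))))
      \<longlongrightarrow> lie_deriv X (lie_deriv Y g) x - lie_deriv Y (lie_deriv X g) x) (at_right 0)"
    using C1 by (intro flow_commutator_tendsto XXg YYg XYg YXg cX cY C1_map_lie_differentiable)
  ultimately show ?thesis
    by (intro tendsto_unique[OF trivial_limit_at_right_real])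
qed

section \<open>The control distance\<close>

lemma sr_dist_le:
  assumes jk: "j \<in> {1..m}" "k \<in> {1..m}"
    and st: "s \<ge> 0" "t \<ge> 0" "s + t > 0"
    and flows: "flows_to (f j) s x y" "flows_to (f k) t y z"
  shows "sr_dist f m x z \<le> ennreal (s + t)"
  unfolding sr_dist_def
proof (rule Inf_lower, rule CollectI, intro exI conjI)
  let ?r = "s + t"
  \<comment> \<open>Speeding each field up by \<open>?r\<close> divides its time by
    \<open>?r\<close>, so the times add up to 1. The field \<open>f k\<close> heads the list because
    the last factor of a chain acts first.\<close>
  let ?ps = "[(t / ?r, \<lambda>w. ?r *\<^sub>R f k w), (s / ?r, \<lambda>w. ?r *\<^sub>R f j w)]"
  show "ennreal ?r = ennreal ?r" "?r > 0" "?ps \<noteq> []" using st by auto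
  show "\<forall>p\<in>set ?ps. snd p \<in> {\<lambda>z. ?r *\<^sub>R f j z |j. j \<in> {1..m}}"
    using jk by auto
  show "(\<Sum>p\<leftarrow>?ps. \<bar>fst p\<bar>) \<le> 1"
    using st by (simp add: add_divide_distrib[symmetric])
  have "flows_to (\<lambda>w. ?r *\<^sub>R f j w) (s / ?r) x y" "flows_to (\<lambda>w. ?r *\<^sub>R f k w) (t / ?r) y z"
    using flows st by (auto intro!: flows_to_rescale)
  then show "flow_chain ?ps x z" by auto
qed

text \<open>Inversion is antitone on all of [0, \<infinity>], so distances 0 and \<infinity> are
  included.\<close>

lemma divide_left_mono_ennreal:
  fixes a b c :: ennreal
  assumes "a \<le> b"
  shows "c / b \<le> c / a"
proof -
  have "inverse b \<le> inverse a"
    using assms unfolding less_eq_ennreal.rep_eq inverse_ennreal.rep_eq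
    by (rule ereal_inverse_antimono[OF enn2ereal_nonneg])
  then show ?thesis
    unfolding divide_ennreal_def by (rule mult_left_mono) simp
qed

text \<open>By \<open>sr_dist_le\<close> the distance is at most the total time, so dividing by the
  distance gives the larger quotient, and the finite supremum serves as \<open>C\<close>.\<close>

lemma d_lipschitz_on_bound:
  assumes "d_lipschitz_on f m A h"
  obtains C where "C \<ge> 0" "\<And>x y z s t j k. \<lbrakk>x \<in> A; z \<in> A; j \<in> {1..m}; k \<in> {1..m}; s \<ge> 0; t \<ge> 0;
    flows_to (f j) s x y; flows_to (f k) t y z\<rbrakk> \<Longrightarrow> norm (h x - h z) \<le> C * (s + t)"
proof -
  define S where "S = (SUP (x, y)\<in>{(x, y). x \<in> A \<and> y \<in> A \<and> x \<noteq> y}.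
      ennreal (norm (h x - h y)) / sr_dist f m x y)"
  have "S < \<infinity>" using assms unfolding d_lipschitz_on_def S_def .
  then obtain C where C: "C \<ge> 0" "S = ennreal C"
    by (metis ennreal_cases infinity_ennreal_def less_irrefl)
  have "norm (h x - h z) \<le> C * (s + t)"
    if A: "x \<in> A" "z \<in> A" and jk: "j \<in> {1..m}" "k \<in> {1..m}" and st: "s \<ge> 0" "t \<ge> 0"
      and flows: "flows_to (f j) s x y" "flows_to (f k) t y z" for x y z s t j k
  proof (cases "x = z")
    case True
    then show ?thesis using C(1) st by simp
  next
    case False
    have "s + t > 0"
    proof (rule ccontr)
      assume "\<not> s + t > 0"
      then have "s = 0" "t = 0" using st by auto
      then show False using flows False by (auto simp: flows_to_def)
    qed
    have "ennreal (norm (h x - h z) / (s + t)) = ennreal (norm (h x - h z)) / ennreal (s + t)"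
      using \<open>s + t > 0\<close> by (simp add: divide_ennreal)
    also have "\<dots> \<le> ennreal (norm (h x - h z)) / sr_dist f m x z"
      by (intro divide_left_mono_ennreal sr_dist_le[OF jk st \<open>s + t > 0\<close> flows])
    also have "\<dots> \<le> S"
      unfolding S_def using A False by (intro SUP_upper2[of "(x, z)"]) auto
    finally show ?thesis
      using C \<open>s + t > 0\<close> by (simp add: pos_divide_le_eq)
  qed
  with C(1) show thesis by (rule that)
qed

text \<open>Chains with times up to some \<open>a\<close> stay in one ball, where \<open>h\<close>
  has a single Lipschitz constant, and the distance travelled is at most the total time.\<close>

lemma d_lipschitz_imp_chain_continuous:
  fixes f :: "nat \<Rightarrow> 'a::euclidean_space \<Rightarrow> 'a"
  assumes C1: "C1_map (f j)" "C1_map (f k)" and jk: "j \<in> {1..m}" "k \<in> {1..m}"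
    and lip: "\<And>A. bounded A \<Longrightarrow> d_lipschitz_on f m A h"
  shows "chain_continuous (f j) (f k) h x"
  unfolding chain_continuous_def
proof (intro allI impI)
  fix e :: real assume "e > 0"
  let ?p = "\<lambda>s. flow (f j) s x" and ?q = "\<lambda>s t. flow (f k) t (flow (f j) s x)"
  obtain a K where a: "a > 0" "K \<ge> 0" "?p 0 = x"
    "\<And>s. s \<in> {0..a} \<Longrightarrow> (?p has_vector_derivative f j (?p s)) (at s within {0..a})"
    "\<And>s. s \<in> {0..a} \<Longrightarrow> ?q s 0 = ?p s"
    "\<And>s t. s \<in> {0..a} \<Longrightarrow> t \<in> {0..a} \<Longrightarrow>
      (?q s has_vector_derivative f k (?q s t)) (at t within {0..a})"
    "\<And>s t. s \<in> {0..a} \<Longrightarrow> t \<in> {0..a} \<Longrightarrow> norm (?q s t - x) \<le> K * (s + t)"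
    by (rule local_flow_chain[OF C1, of x]) blast
  obtain C where C: "C \<ge> 0" "\<And>y z s t. \<lbrakk>x \<in> cball x (K * (a + a)); z \<in> cball x (K * (a + a));
      s \<ge> 0; t \<ge> 0; flows_to (f j) s x y; flows_to (f k) t y z\<rbrakk> \<Longrightarrow> norm (h x - h z) \<le> C * (s + t)"
    using d_lipschitz_on_bound[OF lip[OF bounded_cball]] jk by metis
  have bound: "norm (h (?q s t) - h x) \<le> C * (s + t)" if st: "s \<in> {0..a}" "t \<in> {0..a}" for s t
  proof -
    have "K * (s + t) \<le> K * (a + a)" using st a(2) by (intro mult_left_mono) auto
    then have "?q s t \<in> cball x (K * (a + a))"
      using a(7)[OF st] by (simp add: dist_norm norm_minus_commute)
    moreover have "flows_to (f j) s x (?p s)"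
      using flows_to_integral_curve[of "{0..a}" ?p "f j" 0 s, OF a(4)] st a(1,3) by auto
    moreover have "flows_to (f k) t (?p s) (?q s t)"
      using flows_to_integral_curve[of "{0..a}" "?q s" "f k" 0 t, OF a(6)] st a(1) a(5)[of s] by auto
    ultimately show ?thesis
      using C(2)[of "?q s t" s t "?p s"] st a(1,2) by (simp add: norm_minus_commute)
  qed
  \<comment> \<open>Chosen so that \<open>2 * C * d \<le> e\<close>; the added 1 keeps the
    denominator positive when \<open>C = 0\<close>.\<close>
  define d where "d = min a (e / (2 * C + 1))"
  have d: "d > 0" "d \<le> a" "d * (2 * C + 1) \<le> e"
    using a(1) C(1) \<open>e > 0\<close> pos_le_divide_eq[of "2 * C + 1" d e] by (auto simp: d_def)
  have "norm (h (?q s t) - h x) \<le> e" if st: "s \<in> {0..d}" "t \<in> {0..d}" for s t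
  proof -
    have "norm (h (?q s t) - h x) \<le> C * (s + t)" using st d(2) by (intro bound) auto
    also have "\<dots> \<le> C * (d + d)" using st C(1) by (intro mult_left_mono) auto
    also have "\<dots> \<le> e" using d(1,3) by (simp add: algebra_simps)
    finally show ?thesis .
  qed
  with d(1) show "\<exists>d>0. \<forall>s\<in>{0..d}. \<forall>t\<in>{0..d}. norm (h (?q s t) - h x) \<le> e" by blast
qed

section \<open>The identity for double commutators\<close>

theorem theorem1p1:
  fixes f :: "nat \<Rightarrow> real ^ 'n \<Rightarrow> real ^ 'n" and m :: nat
  assumes C1: "\<And>j. j \<in> {1..m} \<Longrightarrow> C1_map (f j)"
    and reg: "\<And>j. j \<in> {1..m} \<Longrightarrow> C_k1_H_loc f m 2 (f j)"
  shows "\<forall>i\<in>{1..m}. \<forall>j\<in>{1..m}. \<forall>k\<in>{1..m}.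
           \<forall>\<psi> :: real ^ 'n \<Rightarrow> real. C1_map \<psi> \<longrightarrow>
             vf_op (double_comm_coeff f i j k) \<psi> = vf_op (ad_coeff f i j k) \<psi>"
proof (intro ballI allI impI)
  fix i j k and \<psi> :: "real ^ 'n \<Rightarrow> real"
  assume ijk: "i \<in> {1..m}" "j \<in> {1..m}" "k \<in> {1..m}"
  \<comment> \<open>In the word \<open>[a, b]\<close> the derivative along \<open>f a\<close> is the
    outer one, so the regularity assumption covers all second Lie derivatives of the
    coefficients.\<close>
  have second: "lie_differentiable (f a) (lie_deriv (f b) (f c)) z"
    "bounded A \<Longrightarrow> d_lipschitz_on f m A (lie_deriv (f a) (lie_deriv (f b) (f c)))"
    if "a \<in> {1..m}" "b \<in> {1..m}" "c \<in> {1..m}" for a b c z A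
    using reg[OF that(3)] that(1,2) unfolding C_k1_H_loc_def
    by (auto dest!: spec[of _ "[a, b]"])
  have "double_comm_coeff f i j k x = ad_coeff f i j k x" for x
  proof -
    \<comment> \<open>The commutator formula for \<open>g = f i\<close>; the words
      \<open>[j, j]\<close> and \<open>[k, k]\<close> supply the continuity along chains.\<close>
    have "lie_deriv (f j) (lie_deriv (f k) (f i)) x - lie_deriv (f k) (lie_deriv (f j) (f i)) x
        = vf_op (comm_coeff f j k) (f i) x"
      unfolding comm_coeff_def[abs_def] using ijk
      by (intro lie_deriv_commutator d_lipschitz_imp_chain_continuous second(1) C1) (auto intro: second(2))
    moreover have "lie_deriv (f i) (comm_coeff f j k) x
        = lie_deriv (f i) (lie_deriv (f j) (f k)) x - lie_deriv (f i) (lie_deriv (f k) (f j)) x"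
      unfolding comm_coeff_def[abs_def] using ijk by (intro lie_deriv_diff second)
    ultimately show ?thesis
      by (simp add: double_comm_coeff_def ad_coeff_def algebra_simps)
  qed
  then have "double_comm_coeff f i j k = ad_coeff f i j k" by (rule ext)
  then show "vf_op (double_comm_coeff f i j k) \<psi> = vf_op (ad_coeff f i j k) \<psi>" by simp
qed

end
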